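(* For positive integers $g$ and $s$, let $\mu_g^{(s)}$ be the infinite lower-triangular matrix defined by $(\mu_g^{(s)})_{i,j\ge 1}:=M_g^{(s)}(i+g+s-1,\,j+g+s-1)$ and let $\gamma_g^{(s)}$ be the infinite lower-triangular matrix defined by $(\gamma_g^{(s)})_{i,j\ge 1}:=K_g^{(s)}(i-j,\,j+s-1)$. Then $\mu_g^{(s)}$ and $\gamma_g^{(s)}$ are inverses of one another.
   Context: A partition $\lambda=(\lambda_1,\ldots,\lambda_{\ell(\lambda)})$ is a nondecreasing finite sequence of positive integers $\lambda_1\le\cdots\le\lambda_{\ell(\lambda)}$; $|\lambda|$ is the sum of its parts and $\ell(\lambda)$ its number of parts. A composition $\kappa=(\kappa_1,\ldots,\kappa_{\ell(\kappa)})$ of $n$ is a finite sequence of positive integers (in any order) with sum $|\kappa|=n$; $\ell(\kappa)$ is its number of parts. The empty sequence is allowed as a partition and as a composition (of $0$). For a nonnegative integer $g$ and a positive integer $s$: $\mathscr{P}_g^{(s)}$ is the set of partitions $\lambda$ with all parts at least $s$ and $\lambda_{i+1}-\lambda_i\ge g$ for all $1\le i\le\ell(\lambda)-1$; $\mathscr{C}_g^{(s)}$ is the set of compositions $\kappa$ with all parts at least $s$ and $\kappa_{i+1}-\kappa_i\ge -(g-1)$ for all $1\le i\le\ell(\kappa)-1$. Both contain the empty sequence. The integers $M_g^{(s)}(n,m)$, $n,m\ge 1$, are defined by $$\sum_{m,n\ge 1}M_g^{(s)}(n,m)x^m q^n=\sum_{\lambda\in\mathscr{P}_g^{(s)},\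 \lambda\ne\emptyset}(-1)^{\ell(\lambda)+1}x^{\lambda_{\ell(\lambda)}}q^{|\lambda|},$$ so that $M_g^{(s)}(n,m)$ is the sum of $(-1)^{\ell(\lambda)+1}$ over nonempty $\lambda\in\mathscr{P}_g^{(s)}$ of size $n$ with largest part $m$. For a nonnegative integer $m$, a composition $\kappa$ is called $m$-step if $\kappa_j\le m+\sum_{i=0}^{j-1}\kappa_i$ for each part $\kappa_j$ ($1\le j\le\ell(\kappa)$), with the convention $\kappa_0=0$; the empty composition is $m$-step. $K_g^{(s)}(n,m)$ denotes the number of $m$-step compositions of $n$ in $\mathscr{C}_g^{(s)}$, with $K_g^{(s)}(n,m)=0$ for $n<0$. Rows and columns of the matrices are indexed by the positive integers, $i$ being the row index and $j$ the column index. *)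

theory Defs
  imports Main
begin

section \<open>Partitions and compositions\<close>

text \<open>Both are lists of positive natural numbers; the part with index \<open>i\<close> in the usual
  one-based numbering is \<open>xs ! (i - 1)\<close>.  Partitions are written in nondecreasing order.\<close>

definition composition :: "nat list \<Rightarrow> bool" where
  "composition xs \<longleftrightarrow> (\<forall>x\<in>set xs. 0 < x)"

definition partition :: "nat list \<Rightarrow> bool" where
  "partition xs \<longleftrightarrow> sorted xs \<and> (\<forall>x\<in>set xs. 0 < x)"

definition gap_partitions :: "nat \<Rightarrow> nat \<Rightarrow> nat list set" where
  "gap_partitions g s = {xs. partition xs \<and> (\<forall>x\<in>set xs. s \<le> x) \<and>
     (\<forall>i. Suc i < length xs \<longrightarrow> int (xs ! Suc i) - int (xs ! i) \<ge> int g)}"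

definition gap_compositions :: "nat \<Rightarrow> nat \<Rightarrow> nat list set" where
  "gap_compositions g s = {xs. composition xs \<and> (\<forall>x\<in>set xs. s \<le> x) \<and>
     (\<forall>i. Suc i < length xs \<longrightarrow> int (xs ! Suc i) - int (xs ! i) \<ge> - (int g - 1))}"

definition m_step :: "nat \<Rightarrow> nat list \<Rightarrow> bool" where
  "m_step m xs \<longleftrightarrow> (\<forall>j<length xs. xs ! j \<le> m + (\<Sum>i<j. xs ! i))"

text \<open>The coefficient of \<open>x\<^sup>m q\<^sup>n\<close> in the generating function
  \<open>\<Sum>\<lambda>. (-1) ^ (length \<lambda> + 1) * x ^ last \<lambda> * q ^ sum_list \<lambda>\<close> over the nonempty members of
  \<open>gap_partitions g s\<close>; only finitely many partitions contribute to it
  (see \<open>finite_gap_partitions\<close>).\<close>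

definition M :: "nat \<Rightarrow> nat \<Rightarrow> nat \<Rightarrow> nat \<Rightarrow> int" where
  "M g s n m = (\<Sum>xs \<in> {xs \<in> gap_partitions g s. xs \<noteq> [] \<and> sum_list xs = n \<and> last xs = m}.
     (-1) ^ (length xs + 1))"

text \<open>The size \<open>n\<close> is an integer so that the value is \<open>0\<close> for negative \<open>n\<close>.\<close>

definition K :: "nat \<Rightarrow> nat \<Rightarrow> int \<Rightarrow> nat \<Rightarrow> int" where
  "K g s n m = int (card {xs \<in> gap_compositions g s. m_step m xs \<and> int (sum_list xs) = n})"

lemma finite_compositions: "finite {xs. composition xs \<and> sum_list xs = n}"
proof (rule finite_subset)
  have "length xs \<le> sum_list xs" if "composition xs" for xs
    using that by (induction xs) (auto simp: composition_def)
  moreover have "set xs \<subseteq> {..n}" if "sum_list xs = n" for xs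
    using that member_le_sum_list by fastforce
  ultimately show "{xs. composition xs \<and> sum_list xs = n}
      \<subseteq> {xs. set xs \<subseteq> {..n} \<and> length xs \<le> n}"
    by blast
qed (simp add: finite_lists_length_le)

lemma finite_gap_partitions:
  "finite {xs \<in> gap_partitions g s. xs \<noteq> [] \<and> sum_list xs = n \<and> last xs = m}"
  by (rule finite_subset[OF _ finite_compositions[of n]])
     (auto simp: gap_partitions_def partition_def composition_def)

lemma finite_gap_compositions:
  "finite {xs \<in> gap_compositions g s. m_step m xs \<and> int (sum_list xs) = n}"
  by (rule finite_subset[OF _ finite_compositions[of "nat n"]])
     (auto simp: gap_compositions_def)

lemma K_neg: "n < 0 \<Longrightarrow> K g s n m = 0"
proof -
  assume "n < 0"
  then have "{xs \<in> gap_compositions g s. m_step m xs \<and> int (sum_list xs) = n} = {}"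
    by auto
  then show ?thesis
    unfolding K_def by (simp only: card.empty of_nat_0)
qed


section \<open>Infinite matrices\<close>

text \<open>An infinite matrix is a function of row and column, of which only the values at
  positive indices matter.\<close>

type_synonym inf_matrix = "nat \<Rightarrow> nat \<Rightarrow> int"

definition lower_triangular :: "inf_matrix \<Rightarrow> bool" where
  "lower_triangular A \<longleftrightarrow> (\<forall>i\<ge>1. \<forall>j\<ge>1. i < j \<longrightarrow> A i j = 0)"

text \<open>\<open>A\<close> times \<open>B\<close> is the identity: each entry of the product has only finitely many nonzero
  terms, and summing these gives the Kronecker delta.\<close>

definition product_is_identity :: "inf_matrix \<Rightarrow> inf_matrix \<Rightarrow> bool" where
  "product_is_identity A B \<longleftrightarrow> (\<forall>i\<ge>1. \<forall>j\<ge>1.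
     finite {k. 1 \<le> k \<and> A i k * B k j \<noteq> 0} \<and>
     (\<Sum>k \<in> {k. 1 \<le> k \<and> A i k * B k j \<noteq> 0}. A i k * B k j) = (if i = j then 1 else 0))"

definition inverse_matrices :: "inf_matrix \<Rightarrow> inf_matrix \<Rightarrow> bool" where
  "inverse_matrices A B \<longleftrightarrow> product_is_identity A B \<and> product_is_identity B A"

definition mu :: "nat \<Rightarrow> nat \<Rightarrow> inf_matrix" where
  "mu g s i j = M g s (i + g + s - 1) (j + g + s - 1)"

definition gamma :: "nat \<Rightarrow> nat \<Rightarrow> inf_matrix" where
  "gamma g s i j = K g s (int i - int j) (j + s - 1)"

end

theory Submission
  imports Defs
begin

text \<open>An entry of \<open>gamma g s\<close> times \<open>mu g s\<close> is a signed count of pairs \<open>(xs, ys)\<close>, where \<open>xs\<close>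
  is a gap partition with a prescribed largest part \<open>m \<ge> g + s\<close>, \<open>ys\<close> is a gap composition
  that is \<open>(sum_list xs - g)\<close>-step, and the two sizes add up to a prescribed total; the sign is
  \<open>(-1) ^ (length xs + 1)\<close>.  The pairs cancel by moving one part across: either the smallest
  part of \<open>xs\<close> becomes the first part of \<open>ys\<close>, or the first part of \<open>ys\<close> becomes the smallest
  part of \<open>xs\<close>.  Both moves keep the total and reverse the sign.

  At most one of the moves is legal, because the conditions on neighbouring parts are
  complementary.  A part \<open>x\<close> may stand before \<open>y\<close> in a gap composition iff \<open>x < y + g\<close>,
  and \<open>y\<close> may stand before \<open>x\<close> in a gap partition iff \<open>y + g \<le> x\<close>.
  The step condition is invariant: putting \<open>y\<close> in front of a composition lowers the
  step bound by \<open>y\<close>, which is the change in \<open>sum_list xs\<close>.  It also resolves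
  the case where \<open>xs\<close> is the single part \<open>m\<close>, which must not leave \<open>xs\<close>: the first part of
  \<open>ys\<close>, if there is one, is then at most \<open>m - g\<close>, so it can be moved.  The only pair that survives is
  \<open>([m], [])\<close>, whose total is \<open>m\<close>, and this gives the identity matrix
  (\<open>signed_sum_step_pairs\<close>, \<open>gamma_times_mu\<close>).  The product in the other order is then the
  identity as well, since a lower-triangular left inverse of a lower-triangular matrix is a right inverse
  (\<open>lower_triangular_left_inverse_imp_right_inverse\<close>).\<close>

section \<open>Prepending a part\<close>

lemma all_Suc_less_Suc:
  "(\<forall>i. Suc i < Suc n \<longrightarrow> P i) \<longleftrightarrow> (n > 0 \<longrightarrow> P 0) \<and> (\<forall>i. Suc i < n \<longrightarrow> P (Suc i))"
proof (intro iffI conjI impI allI)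
  fix i assume P: "(n > 0 \<longrightarrow> P 0) \<and> (\<forall>i. Suc i < n \<longrightarrow> P (Suc i))" and "Suc i < Suc n"
  then show "P i" by (cases i) auto
qed auto

lemma gap_partitions_Cons_Cons:
  "x # y # xs \<in> gap_partitions g s \<longleftrightarrow>
     0 < x \<and> s \<le> x \<and> x + g \<le> y \<and> y # xs \<in> gap_partitions g s"
  unfolding gap_partitions_def partition_def mem_Collect_eq length_Cons
    all_Suc_less_Suc[of "Suc (length xs)"]
  by fastforce

lemma gap_partitions_single: "[x] \<in> gap_partitions g s \<longleftrightarrow> 0 < x \<and> s \<le> x"
  by (auto simp: gap_partitions_def partition_def)

lemma gap_compositions_Nil: "[] \<in> gap_compositions g s"
  by (simp add: gap_compositions_def composition_def)

lemma gap_compositions_Cons: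
  "x # xs \<in> gap_compositions g s \<longleftrightarrow>
     0 < x \<and> s \<le> x \<and> (xs = [] \<or> x < hd xs + g) \<and> xs \<in> gap_compositions g s"
proof (cases xs)
  case Nil
  then show ?thesis by (auto simp: gap_compositions_def composition_def)
next
  case (Cons y ys)
  show ?thesis
    unfolding gap_compositions_def composition_def mem_Collect_eq length_Cons Cons
      all_Suc_less_Suc[of "Suc (length ys)"]
    by auto
qed

lemma m_step_Nil: "m_step m []"
  by (simp add: m_step_def)

lemma m_step_Cons: "m_step m (x # xs) \<longleftrightarrow> x \<le> m \<and> m_step (m + x) xs"
  by (simp add: m_step_def All_less_Suc2 sum.lessThan_Suc_shift add.assoc del: sum.lessThan_Suc)

lemma last_le_sum_list: "xs \<noteq> [] \<Longrightarrow> last xs \<le> sum_list (xs :: nat list)"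
  by (simp add: member_le_sum_list)

section \<open>The sign-reversing move\<close>

definition step_pairs :: "nat \<Rightarrow> nat \<Rightarrow> nat \<Rightarrow> nat \<Rightarrow> (nat list \<times> nat list) set" where
  "step_pairs g s t m = {(xs, ys). xs \<in> gap_partitions g s \<and> xs \<noteq> [] \<and> last xs = m \<and>
     ys \<in> gap_compositions g s \<and> m_step (sum_list xs - g) ys \<and> sum_list xs + sum_list ys = t}"

lemma finite_step_pairs: "finite (step_pairs g s t m)"
proof (rule finite_subset)
  let ?C = "\<Union>n\<le>t. {xs. composition xs \<and> sum_list xs = n}"
  show "step_pairs g s t m \<subseteq> ?C \<times> ?C"
    by (auto simp: step_pairs_def gap_partitions_def gap_compositions_def partition_def
        composition_def)
  show "finite (?C \<times> ?C)"
    by (simp add: finite_compositions)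
qed

text \<open>The conditions on neighbouring parts trade places as in the introduction; what needs an
  argument is the step bound when the smallest part \<open>x\<close> of \<open>x # x' # xs\<close> moves: it must satisfy
  \<open>x \<le> sum_list (x' # xs) - g\<close>, and it does because \<open>x + g \<le> x'\<close>.  The largest part stays in
  place because a part leaves the partition only if another one remains.\<close>

lemma step_pairs_move_bij:
  assumes "g + s \<le> m"
  shows "bij_betw (\<lambda>(xs, ys). (hd ys # xs, tl ys))
    {(xs, ys) \<in> step_pairs g s t m. ys \<noteq> [] \<and> hd ys + g \<le> hd xs}
    {(xs, ys) \<in> step_pairs g s t m. tl xs \<noteq> [] \<and> (ys = [] \<or> hd xs < hd ys + g)}"
    (is "bij_betw ?f ?D ?E")
proof (rule bij_betw_byWitness[where f' = "\<lambda>(xs, ys). (tl xs, hd xs # ys)"])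
  show "?f ` ?D \<subseteq> ?E"
  proof (rule image_subsetI)
    fix p assume "p \<in> ?D"
    then obtain x xs y ys where p: "p = (x # xs, y # ys)" and P: "p \<in> step_pairs g s t m"
      and le: "y + g \<le> x"
      by (auto simp: step_pairs_def neq_Nil_conv)
    have "m \<le> x + sum_list xs"
      using P p last_le_sum_list[of "x # xs"] by (auto simp: step_pairs_def)
    then have "y + (x + sum_list xs) - g = x + sum_list xs - g + y"
      using assms by simp
    then show "?f p \<in> ?E"
      using P p le
      by (auto simp: step_pairs_def gap_partitions_Cons_Cons gap_compositions_Cons m_step_Cons)
  qed
  show "(\<lambda>(xs, ys). (tl xs, hd xs # ys)) ` ?E \<subseteq> ?D"
  proof (rule image_subsetI)
    fix p assume "p \<in> ?E"
    then obtain x x' xs ys where p: "p = (x # x' # xs, ys)" and P: "p \<in> step_pairs g s t m"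
      and le: "ys = [] \<or> x < hd ys + g"
      by (auto simp: step_pairs_def neq_Nil_conv)
    have "m \<le> x' + sum_list xs"
      using P p last_le_sum_list[of "x' # xs"] by (auto simp: step_pairs_def)
    then have "x + (x' + sum_list xs) - g = x' + sum_list xs - g + x"
      using assms by simp
    then show "(case p of (xs, ys) \<Rightarrow> (tl xs, hd xs # ys)) \<in> ?D"
      using P p le
      by (auto simp: step_pairs_def gap_partitions_Cons_Cons gap_compositions_Cons m_step_Cons)
  qed
  have "xs \<noteq> []" if "(xs, ys) \<in> step_pairs g s t m" for xs ys
    using that by (simp add: step_pairs_def)
  then show "\<forall>p\<in>?E. ?f (case p of (xs, ys) \<Rightarrow> (tl xs, hd xs # ys)) = p"
    by fastforce
qed fastforce

lemma eq_if_singletonI: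
  assumes "\<And>x. x \<in> R \<Longrightarrow> x = a \<and> P" and "P \<Longrightarrow> a \<in> R"
  shows "R = (if P then {a} else {})"
  using assms by auto

text \<open>When \<open>xs\<close> has one part, the step condition bounds the first part of \<open>ys\<close> by \<open>m - g\<close>;
  hence a pair outside both move sets has \<open>ys = []\<close>.\<close>

lemma step_pairs_unmoved:
  assumes "g + s \<le> m" "0 < m"
  shows "{(xs, ys) \<in> step_pairs g s t m. \<not> (ys \<noteq> [] \<and> hd ys + g \<le> hd xs) \<and>
      \<not> (tl xs \<noteq> [] \<and> (ys = [] \<or> hd xs < hd ys + g))} = (if t = m then {([m], [])} else {})"
    (is "?R = _")
proof (rule eq_if_singletonI)
  show "p = ([m], []) \<and> t = m" if "p \<in> ?R" for p
  proof -
    obtain xs ys where p: "p = (xs, ys)" by force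
    have "xs = [m]"
      using that p by (cases xs) (auto simp: step_pairs_def)
    moreover have "ys = []"
      using that p \<open>xs = [m]\<close> assms by (cases ys) (auto simp: step_pairs_def m_step_Cons)
    ultimately show ?thesis
      using that p by (simp add: step_pairs_def)
  qed
  show "([m], []) \<in> ?R" if "t = m"
    using that assms
    by (simp add: step_pairs_def gap_partitions_single gap_compositions_Nil m_step_Nil)
qed

lemma signed_sum_step_pairs:
  assumes "g + s \<le> m" "0 < m"
  shows "(\<Sum>(xs, ys) \<in> step_pairs g s t m. (-1) ^ (length xs + 1)) = (if t = m then 1 else 0 :: int)"
proof -
  let ?w = "\<lambda>(xs :: nat list, ys :: nat list). (-1 :: int) ^ (length xs + 1)"
  let ?D = "{(xs, ys) \<in> step_pairs g s t m. ys \<noteq> [] \<and> hd ys + g \<le> hd xs}"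
  let ?E = "{(xs, ys) \<in> step_pairs g s t m. tl xs \<noteq> [] \<and> (ys = [] \<or> hd xs < hd ys + g)}"
  let ?R = "{(xs, ys) \<in> step_pairs g s t m. \<not> (ys \<noteq> [] \<and> hd ys + g \<le> hd xs) \<and>
      \<not> (tl xs \<noteq> [] \<and> (ys = [] \<or> hd xs < hd ys + g))}"
  have fin: "finite ?D" "finite ?E" "finite ?R"
    by (auto intro: finite_subset[OF _ finite_step_pairs[of g s t m]])
  have "step_pairs g s t m = (?D \<union> ?E) \<union> ?R"
    by blast
  then have "sum ?w (step_pairs g s t m) = sum ?w ((?D \<union> ?E) \<union> ?R)"
    by (rule arg_cong)
  also have "\<dots> = sum ?w (?D \<union> ?E) + sum ?w ?R"
    using fin by (intro sum.union_disjoint) auto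
  also have "sum ?w (?D \<union> ?E) = sum ?w ?D + sum ?w ?E"
    using fin by (intro sum.union_disjoint) auto
  also have "sum ?w ?E = (\<Sum>p \<in> ?D. ?w (case p of (xs, ys) \<Rightarrow> (hd ys # xs, tl ys)))"
    by (rule sum.reindex_bij_betw[OF step_pairs_move_bij[OF assms(1)], symmetric])
  also have "\<dots> = (\<Sum>p \<in> ?D. - ?w p)"
    by (rule sum.cong) auto
  also have "\<dots> = - sum ?w ?D"
    by (rule sum_negf)
  also have "sum ?w ?R = (if t = m then 1 else 0)"
    unfolding step_pairs_unmoved[OF assms] by simp
  finally show ?thesis
    by simp
qed

section \<open>The matrix product\<close>

text \<open>Grouping the pairs by \<open>sum_list xs = k + g + s - 1\<close> turns the signed count into the
  matrix product, because the step bound \<open>sum_list xs - g\<close> is then \<open>k + s - 1\<close>.  The range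
  \<open>1 \<le> k \<le> i\<close> loses no pair: \<open>sum_list xs\<close> is at least \<open>last xs \<ge> g + s\<close>.\<close>

lemma gamma_times_mu:
  assumes "1 \<le> i" "1 \<le> j" "1 \<le> s"
  shows "(\<Sum>k=1..i. gamma g s i k * mu g s k j) = (if i = j then 1 else 0)"
proof -
  define t where "t = i + g + s - 1"
  define m where "m = j + g + s - 1"
  let ?A = "\<lambda>k. {xs \<in> gap_partitions g s. xs \<noteq> [] \<and> sum_list xs = k + g + s - 1 \<and> last xs = m}"
  let ?B = "\<lambda>k. {ys \<in> gap_compositions g s. m_step (k + s - 1) ys \<and>
      int (sum_list ys) = int i - int k}"
  let ?w = "\<lambda>(xs :: nat list, ys :: nat list). (-1 :: int) ^ (length xs + 1)"
  have m: "g + s \<le> m" "0 < m"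
    using assms by (auto simp: m_def)
  have "gamma g s i k * mu g s k j = sum ?w (?A k \<times> ?B k)" for k
    by (simp add: gamma_def mu_def K_def M_def m_def sum.cartesian_product[symmetric]
        sum_distrib_left mult.commute)
  then have "(\<Sum>k=1..i. gamma g s i k * mu g s k j) = (\<Sum>k=1..i. sum ?w (?A k \<times> ?B k))"
    by simp
  also have "\<dots> = sum ?w (\<Union>k\<in>{1..i}. ?A k \<times> ?B k)"
  proof (rule sum.UNION_disjoint[symmetric])
    show "\<forall>k\<in>{1..i}. finite (?A k \<times> ?B k)"
      by (intro ballI finite_cartesian_product finite_gap_partitions finite_gap_compositions)
  qed (use assms in auto)
  also have "(\<Union>k\<in>{1..i}. ?A k \<times> ?B k) = step_pairs g s t m"
  proof (intro equalityI subsetI)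
    fix p assume "p \<in> (\<Union>k\<in>{1..i}. ?A k \<times> ?B k)"
    then obtain k xs ys where k: "1 \<le> k" "k \<le> i" and p: "p = (xs, ys)" "xs \<in> ?A k" "ys \<in> ?B k"
      by auto
    have "sum_list xs - g = k + s - 1"
      using k p assms by auto
    moreover have "sum_list xs + sum_list ys = t"
      using k p assms unfolding t_def by auto
    ultimately show "p \<in> step_pairs g s t m"
      using p by (simp add: step_pairs_def)
  next
    fix p assume "p \<in> step_pairs g s t m"
    then obtain xs ys where p: "p = (xs, ys)" and
      xs: "xs \<in> gap_partitions g s" "xs \<noteq> []" "last xs = m" and
      ys: "ys \<in> gap_compositions g s" "m_step (sum_list xs - g) ys" and
      t: "sum_list xs + sum_list ys = t"
      by (auto simp: step_pairs_def)
    define k where "k = sum_list xs + 1 - (g + s)"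
    have "g + s \<le> sum_list xs"
      using last_le_sum_list[OF xs(2)] xs(3) m(1) by simp
    then have "sum_list xs = k + g + s - 1" "1 \<le> k" "sum_list xs - g = k + s - 1"
      "int (sum_list ys) = int i - int k"
      using t assms by (auto simp: k_def t_def)
    then show "p \<in> (\<Union>k\<in>{1..i}. ?A k \<times> ?B k)"
      using p xs ys by (intro UN_I[of k]) auto
  qed
  also have "sum ?w (step_pairs g s t m) = (if t = m then 1 else 0)"
    by (rule signed_sum_step_pairs[OF m])
  also have "\<dots> = (if i = j then 1 else 0)"
    using assms by (auto simp: t_def m_def)
  finally show ?thesis .
qed

lemma lower_triangular_mu: "lower_triangular (mu g s)"
proof -
  have "{xs \<in> gap_partitions g s. xs \<noteq> [] \<and> sum_list xs = i + g + s - 1 \<and>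
      last xs = j + g + s - 1} = {}" if "1 \<le> i" "i < j" for i j
  proof -
    have "\<not> (xs \<noteq> [] \<and> sum_list xs = i + g + s - 1 \<and> last xs = j + g + s - 1)" for xs
      using last_le_sum_list[of xs] that by auto
    then show ?thesis by blast
  qed
  then show ?thesis
    unfolding lower_triangular_def mu_def M_def
    by (intro allI impI) (metis (no_types, lifting) sum.empty)
qed

lemma lower_triangular_gamma: "lower_triangular (gamma g s)"
  by (simp add: lower_triangular_def gamma_def K_neg)

section \<open>Inverses of lower-triangular matrices\<close>

lemma lower_triangular_product_is_identityI:
  assumes "lower_triangular A"
    and prod: "\<And>i j. 1 \<le> i \<Longrightarrow> 1 \<le> j \<Longrightarrow> (\<Sum>k=1..i. A i k * B k j) = (if i = j then 1 else 0)"
  shows "product_is_identity A B"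
  unfolding product_is_identity_def
proof (intro allI impI)
  fix i j :: nat assume ij: "1 \<le> i" "1 \<le> j"
  let ?S = "{k. 1 \<le> k \<and> A i k * B k j \<noteq> 0}"
  have sub: "?S \<subseteq> {1..i}"
  proof
    fix k assume k: "k \<in> ?S"
    then have "\<not> i < k"
      using assms(1) ij by (auto simp: lower_triangular_def)
    with k show "k \<in> {1..i}" by simp
  qed
  then have "(\<Sum>k\<in>?S. A i k * B k j) = (\<Sum>k=1..i. A i k * B k j)"
    by (intro sum.mono_neutral_left) auto
  with sub show "finite ?S \<and> (\<Sum>k\<in>?S. A i k * B k j) = (if i = j then 1 else 0)"
    using prod[OF ij] by (simp add: finite_subset)
qed

text \<open>From \<open>B A = I\<close> one gets \<open>B (A B - I) = 0\<close>.  The diagonal of \<open>B\<close> has no zero,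
  as \<open>B i i * A i i = 1\<close>, so the rows of \<open>A B - I\<close> vanish one after the other.\<close>

lemma lower_triangular_left_inverse_imp_right_inverse:
  assumes lt: "lower_triangular A" and ltB: "lower_triangular B"
    and left: "\<And>i j. 1 \<le> i \<Longrightarrow> 1 \<le> j \<Longrightarrow> (\<Sum>k=1..i. B i k * A k j) = (if i = j then 1 else 0)"
    and "1 \<le> i" and j: "1 \<le> j"
  shows "(\<Sum>k=1..i. A i k * B k j) = (if i = j then 1 else 0)"
proof -
  define C where "C l = (\<Sum>k=1..l. A l k * B k j) - (if l = j then 1 else 0)" for l
  have annihilated: "(\<Sum>l=1..n. B n l * C l) = 0" if n: "1 \<le> n" for n
  proof -
    have "(\<Sum>l=1..n. B n l * (\<Sum>k=1..l. A l k * B k j))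
        = (\<Sum>l=1..n. B n l * (\<Sum>k=1..n. A l k * B k j))"
      using lt by (intro sum.cong refl arg_cong2[where f = "(*)"] sum.mono_neutral_left)
        (auto simp: lower_triangular_def)
    also have "\<dots> = (\<Sum>k=1..n. (\<Sum>l=1..n. B n l * A l k) * B k j)"
      unfolding sum_distrib_left sum_distrib_right by (subst sum.swap) (simp add: mult.assoc)
    also have "\<dots> = (\<Sum>k=1..n. (if n = k then 1 else 0) * B k j)"
      by (intro sum.cong refl arg_cong2[where f = "(*)"] left) (use n in auto)
    also have "\<dots> = B n j"
      using n by (simp add: if_distrib[where f = "\<lambda>x. x * _"] sum.delta cong: if_cong)
    finally have assoc: "(\<Sum>l=1..n. B n l * (\<Sum>k=1..l. A l k * B k j)) = B n j" .
    have "(\<Sum>l=1..n. B n l * (if l = j then 1 else 0)) = (if j \<le> n then B n j else 0)"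
      using j by (simp add: if_distrib[where f = "\<lambda>x. _ * x"] sum.delta cong: if_cong)
    moreover have "B n j = 0" if "n < j"
      using ltB n j that by (simp add: lower_triangular_def)
    ultimately show ?thesis
      using assoc by (simp add: C_def right_diff_distrib sum_subtractf)
  qed
  have "C n = 0" if "1 \<le> n" for n
    using that
  proof (induction n rule: less_induct)
    case (less n)
    have "(\<Sum>l=1..n. B n l * A l n) = (\<Sum>l\<in>{n}. B n l * A l n)"
      using lt less.prems by (intro sum.mono_neutral_right) (auto simp: lower_triangular_def)
    then have "B n n \<noteq> 0"
      using left[of n n] less.prems by auto
    have "(\<Sum>l=1..n. B n l * C l) = (\<Sum>l\<in>{n}. B n l * C l)"
      using less by (intro sum.mono_neutral_right) auto
    then show ?case
      using annihilated[OF less.prems] \<open>B n n \<noteq> 0\<close> by simp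
  qed
  then show ?thesis
    using \<open>1 \<le> i\<close> by (simp add: C_def)
qed

theorem theorem3p2:
  fixes g s :: nat
  assumes "g \<ge> 1" and "s \<ge> 1"
  shows "lower_triangular (mu g s) \<and> lower_triangular (gamma g s)
    \<and> inverse_matrices (mu g s) (gamma g s)"
proof -
  have "product_is_identity (gamma g s) (mu g s)"
    using gamma_times_mu assms(2)
    by (intro lower_triangular_product_is_identityI lower_triangular_gamma) auto
  moreover have "product_is_identity (mu g s) (gamma g s)"
  proof (rule lower_triangular_product_is_identityI[OF lower_triangular_mu])
    fix i j :: nat assume "1 \<le> i" "1 \<le> j"
    then show "(\<Sum>k=1..i. mu g s i k * gamma g s k j) = (if i = j then 1 else 0)"
      using assms(2)
      by (subst lower_triangular_left_inverse_imp_right_inverse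
          [OF lower_triangular_mu lower_triangular_gamma]) (simp_all only: gamma_times_mu)
  qed
  ultimately show ?thesis
    by (simp add: inverse_matrices_def lower_triangular_mu lower_triangular_gamma)
qed

end
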